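(* Let $1\le p<\infty$, let $\mu$ be a positive Borel measure on $\mathbb{D}$ satisfying the standing axiom on $D^p_\mu$ stated in the context, and let $\varphi$ be an analytic self-map of $\mathbb{D}$. The following statements are equivalent: (a) $C_\varphi$ maps $\mathcal{B}$ into $M(D^p_\mu)$, i.e. $f\circ\varphi\in M(D^p_\mu)$ for every $f\in\mathcal{B}$; (b) $C_\varphi$ is a bounded operator from $\mathcal{B}$ into $M(D^p_\mu)$; (c) $\sup_{\sigma\in Aut(\mathbb{D})}\int_{\mathbb{D}}|(\varphi\circ\sigma)^{\#}|^p\,d\mu<\infty$.
   Context: $\mathbb{D}=\{z\in\mathbb{C}:|z|<1\}$; $\mathcal{H}(\mathbb{D})$ is the set of analytic functions on $\mathbb{D}$; $Aut(\mathbb{D})$ is the group of disk automorphisms, i.e. one-to-one analytic maps of $\mathbb{D}$ onto itself. A self-map of $\mathbb{D}$ is an analytic function $\varphi:\mathbb{D}\to\mathbb{D}$, and $C_\varphi(f)=f\circ\varphi$ for $f\in\mathcal{H}(\mathbb{D})$. For a self-map $\varphi$, the hyperbolic derivative is $\varphi^{\#}(z)=\frac{|\varphi'(z)|}{1-|\varphi(z)|^2}$. The Bloch space $\mathcal{B}$ is the Banach space of all $f\in\mathcal{H}(\mathbb{D})$ with $\|f\|_{\mathcal{B}}=|f(0)|+\sup_{z\in\mathbb{D}}(1-|z|^2)|f'(z)|<\infty$. For a positive Borel measure $\mu$ on $\mathbb{D}$ and $1\le p<\infty$, $D^p_\mu$ is the space of all $f\in\mathcal{H}(\mathbb{D})$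 with $\|f\|_{D^p_\mu}^p=|f(0)|^p+\int_{\mathbb{D}}|f'|^p\,d\mu<\infty$. Standing axiom: $D^p_\mu$ is a Banach space and the point-evaluation functionals $f\mapsto f(\zeta)$ are uniformly bounded on $D^p_\mu$ for $\zeta$ in compact subsets of $\mathbb{D}$ (for each compact $K\subset\mathbb{D}$ there is $C_K$ with $|f(\zeta)|\le C_K\|f\|_{D^p_\mu}$ for all $\zeta\in K$, $f\in D^p_\mu$). $M(D^p_\mu)$ is the space of all $f\in\mathcal{H}(\mathbb{D})$ with $\|f\|_{M(D^p_\mu)}^p=|f(0)|^p+\sup_{\sigma\in Aut(\mathbb{D})}\int_{\mathbb{D}}|(f\circ\sigma)'|^p\,d\mu<\infty$. *)

theory Defs
  imports "HOL-Complex_Analysis.Complex_Analysis"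
begin

abbreviation unit_disk :: "complex set"
  where "unit_disk \<equiv> ball 0 1"

text \<open>Analytic functions on the disk are represented by total functions that vanish off the
  disk. Two such functions are equal iff they agree on the disk, so the spaces below are
  genuine vector spaces and their norms can be definite.\<close>

definition hol_disk :: "(complex \<Rightarrow> complex) set"
  where "hol_disk = {f. f holomorphic_on unit_disk \<and> (\<forall>z. z \<notin> unit_disk \<longrightarrow> f z = 0)}"

text \<open>The values of self-maps and automorphisms off the disk are arbitrary; nothing below
  depends on them.\<close>

definition disk_self_map :: "(complex \<Rightarrow> complex) \<Rightarrow> bool"
  where "disk_self_map \<phi> \<longleftrightarrow> \<phi> holomorphic_on unit_disk \<and> \<phi> ` unit_disk \<subseteq> unit_disk"

definition disk_aut :: "(complex \<Rightarrow> complex) set"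
  where "disk_aut = {\<sigma>. \<sigma> holomorphic_on unit_disk \<and> bij_betw \<sigma> unit_disk unit_disk}"

definition comp_op :: "(complex \<Rightarrow> complex) \<Rightarrow> (complex \<Rightarrow> complex) \<Rightarrow> complex \<Rightarrow> complex"
  where "comp_op \<phi> f = (\<lambda>z. if z \<in> unit_disk then f (\<phi> z) else 0)"

definition hyp_deriv :: "(complex \<Rightarrow> complex) \<Rightarrow> complex \<Rightarrow> real"
  where "hyp_deriv \<phi> z = norm (deriv \<phi> z) / (1 - (norm (\<phi> z))\<^sup>2)"

definition bloch_space :: "(complex \<Rightarrow> complex) set"
  where "bloch_space =
    {f \<in> hol_disk. bdd_above ((\<lambda>z. (1 - (norm z)\<^sup>2) * norm (deriv f z)) ` unit_disk)}"

definition bloch_norm :: "(complex \<Rightarrow> complex) \<Rightarrow> real"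
  where "bloch_norm f = norm (f 0) + (SUP z\<in>unit_disk. (1 - (norm z)\<^sup>2) * norm (deriv f z))"

definition dirichlet_integral :: "real \<Rightarrow> complex measure \<Rightarrow> (complex \<Rightarrow> complex) \<Rightarrow> ennreal"
  where "dirichlet_integral p \<mu> f = (\<integral>\<^sup>+ z. ennreal (norm (deriv f z) powr p) \<partial>\<mu>)"

definition dirichlet_space :: "real \<Rightarrow> complex measure \<Rightarrow> (complex \<Rightarrow> complex) set"
  where "dirichlet_space p \<mu> = {f \<in> hol_disk. dirichlet_integral p \<mu> f < \<infinity>}"

definition dirichlet_norm :: "real \<Rightarrow> complex measure \<Rightarrow> (complex \<Rightarrow> complex) \<Rightarrow> real"
  where "dirichlet_norm p \<mu> f =
    (norm (f 0) powr p + enn2real (dirichlet_integral p \<mu> f)) powr (1 / p)"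

definition mobius_space :: "real \<Rightarrow> complex measure \<Rightarrow> (complex \<Rightarrow> complex) set"
  where "mobius_space p \<mu> =
    {f \<in> hol_disk. (SUP \<sigma>\<in>disk_aut. dirichlet_integral p \<mu> (f \<circ> \<sigma>)) < \<infinity>}"

definition mobius_norm :: "real \<Rightarrow> complex measure \<Rightarrow> (complex \<Rightarrow> complex) \<Rightarrow> real"
  where "mobius_norm p \<mu> f =
    (norm (f 0) powr p
      + enn2real (SUP \<sigma>\<in>disk_aut. dirichlet_integral p \<mu> (f \<circ> \<sigma>))) powr (1 / p)"

definition banach_function_space ::
    "(complex \<Rightarrow> complex) set \<Rightarrow> ((complex \<Rightarrow> complex) \<Rightarrow> real) \<Rightarrow> bool"
  where "banach_function_space V N \<longleftrightarrow>
    (\<lambda>z. 0) \<in> V \<and>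
    (\<forall>f\<in>V. \<forall>g\<in>V. (\<lambda>z. f z + g z) \<in> V) \<and>
    (\<forall>c. \<forall>f\<in>V. (\<lambda>z. c * f z) \<in> V) \<and>
    (\<forall>f\<in>V. 0 \<le> N f \<and> (N f = 0 \<longleftrightarrow> f = (\<lambda>z. 0))) \<and>
    (\<forall>c. \<forall>f\<in>V. N (\<lambda>z. c * f z) = norm c * N f) \<and>
    (\<forall>f\<in>V. \<forall>g\<in>V. N (\<lambda>z. f z + g z) \<le> N f + N g) \<and>
    (\<forall>F :: nat \<Rightarrow> complex \<Rightarrow> complex.
      (\<forall>n. F n \<in> V) \<and>
      (\<forall>e>0. \<exists>K. \<forall>m\<ge>K. \<forall>n\<ge>K. N (\<lambda>z. F m z - F n z) < e) \<longrightarrow>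
      (\<exists>f\<in>V. (\<lambda>n. N (\<lambda>z. F n z - f z)) \<longlonglongrightarrow> 0))"

definition bounded_operator ::
    "(complex \<Rightarrow> complex) set \<Rightarrow> ((complex \<Rightarrow> complex) \<Rightarrow> real) \<Rightarrow>
     (complex \<Rightarrow> complex) set \<Rightarrow> ((complex \<Rightarrow> complex) \<Rightarrow> real) \<Rightarrow>
     ((complex \<Rightarrow> complex) \<Rightarrow> complex \<Rightarrow> complex) \<Rightarrow> bool"
  where "bounded_operator V N W N' T \<longleftrightarrow>
    (\<forall>f\<in>V. T f \<in> W) \<and>
    (\<forall>f\<in>V. \<forall>g\<in>V. T (\<lambda>z. f z + g z) = (\<lambda>z. T f z + T g z)) \<and>
    (\<forall>c. \<forall>f\<in>V. T (\<lambda>z. c * f z) = (\<lambda>z. c * T f z)) \<and>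
    (\<exists>C. \<forall>f\<in>V. N' (T f) \<le> C * N f)"

end

theory Submission imports Defs begin

text \<open>
  The chain rule gives \<open>\<bar>(f \<circ> \<phi> \<circ> \<sigma>)'\<bar> = \<bar>f' \<circ> \<phi> \<circ> \<sigma>\<bar> \<cdot> \<bar>(\<phi> \<circ> \<sigma>)'\<bar>\<close>. For \<open>f\<close> in the Bloch space the first
  factor is at most \<open>\<parallel>f\<parallel> / (1 - \<bar>\<phi> \<circ> \<sigma>\<bar>\<^sup>2)\<close>, so (c) implies (b). For (a) implies (c) this estimate is
  reversed with finitely many test functions, following Ramey and Ullrich: the lacunary series
  \<open>\<Sum>z^N\<close> over the exponents \<open>N = Q^(2k)\<close>, respectively \<open>N = Q^(2k+1)\<close>, is a Bloch function whose
  derivative is dominated by its \<open>N\<close>-th term, of size about \<open>N\<close>, on the annulus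
  \<open>1 - 1/N \<le> \<bar>z\<bar> \<le> 1 - 1/(QN)\<close>. The annuli of the two series cover \<open>\<bar>z\<bar> \<ge> 1 - 1/Q\<close>, and the identity
  function takes care of the rest of the disk.
\<close>

section \<open>Lacunary power series as Bloch functions\<close>

text \<open>The terms are compared block by block with the geometric series, whose rate
  \<open>1 / (1 - r)\<close> is exactly the growth of a derivative that the Bloch condition
  permits.\<close>

lemma lacunary_partial_sum_le:
  fixes N :: "nat \<Rightarrow> nat" and r :: real
  assumes r: "0 \<le> r" "r < 1" and N: "\<And>k. 2 * N k \<le> N (Suc k)"
  shows "(\<Sum>k<K. real (N k) * r ^ (N k - 1)) \<le> 2 / (1 - r)"
proof -
  have block: "real (n - m) * r ^ (n - 1) \<le> (\<Sum>i=m..<n. r ^ i)" for m n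
  proof -
    have "(\<Sum>i=m..<n. r ^ (n - 1)) \<le> (\<Sum>i=m..<n. r ^ i)"
      by (intro sum_mono power_decreasing) (use r in auto)
    thus ?thesis by simp
  qed
  \<comment> \<open>The \<open>N (Suc K) - N K \<ge> N (Suc K) / 2\<close> powers between two consecutive exponents
    each dominate the power of the new term.\<close>
  have "(\<Sum>k\<le>K. real (N k) * r ^ (N k - 1)) \<le> 2 * (\<Sum>i<N K. r ^ i)" for K
  proof (induction K)
    case 0
    have "real (N 0) * r ^ (N 0 - 1) \<le> (\<Sum>i<N 0. r ^ i)"
      using block[of "N 0" 0] by (simp add: atLeast0LessThan)
    moreover have "0 \<le> (\<Sum>i<N 0. r ^ i)" using r by (intro sum_nonneg) auto
    ultimately show ?case by simp
  next
    case (Suc K)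
    have le: "N K \<le> N (Suc K)" using N[of K] by simp
    have "real (N (Suc K)) \<le> 2 * real (N (Suc K) - N K)"
      using N[of K] by linarith
    hence "real (N (Suc K)) * r ^ (N (Suc K) - 1)
        \<le> 2 * real (N (Suc K) - N K) * r ^ (N (Suc K) - 1)"
      by (intro mult_right_mono) (use r in auto)
    also have "\<dots> \<le> 2 * (\<Sum>i=N K..<N (Suc K). r ^ i)"
      using block[of "N (Suc K)" "N K"] by simp
    finally have "real (N (Suc K)) * r ^ (N (Suc K) - 1) \<le> 2 * (\<Sum>i=N K..<N (Suc K). r ^ i)" .
    moreover have "(\<Sum>i<N (Suc K). r ^ i) = (\<Sum>i<N K. r ^ i) + (\<Sum>i=N K..<N (Suc K). r ^ i)"
      using sum.atLeastLessThan_concat[of 0 "N K" "N (Suc K)" "\<lambda>i. r ^ i"] le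
      by (simp add: atLeast0LessThan)
    ultimately show ?case using Suc.IH by simp
  qed
  moreover have "(\<Sum>k<K. real (N k) * r ^ (N k - 1)) \<le> (\<Sum>k\<le>K. real (N k) * r ^ (N k - 1))"
    by (intro sum_mono2) (use r in auto)
  moreover have "(\<Sum>i<n. r ^ i) \<le> 1 / (1 - r)" for n
    using r by (simp add: sum_gp_strict divide_right_mono)
  ultimately have "(\<Sum>k<K. real (N k) * r ^ (N k - 1)) \<le> 2 * (1 / (1 - r))"
    by (meson mult_left_mono order_trans zero_le_numeral)
  thus ?thesis by simp
qed

lemma lacunary_summable:
  fixes N :: "nat \<Rightarrow> nat" and r :: real
  assumes "0 \<le> r" "r < 1" and "\<And>k. 2 * N k \<le> N (Suc k)"
  shows "summable (\<lambda>k. real (N k) * r ^ (N k - 1))"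
    and "(\<Sum>k. real (N k) * r ^ (N k - 1)) \<le> 2 / (1 - r)"
proof -
  show s: "summable (\<lambda>k. real (N k) * r ^ (N k - 1))"
    by (rule summableI_nonneg_bounded[OF _ lacunary_partial_sum_le])
       (use assms in auto)
  show "(\<Sum>k. real (N k) * r ^ (N k - 1)) \<le> 2 / (1 - r)"
    by (rule suminf_le_const[OF s lacunary_partial_sum_le]) (use assms in auto)
qed

text \<open>The gap series is a power series whose coefficients are the indicator of
  \<open>range N\<close>. Termwise differentiation applies to that series, and reindexing along
  \<open>N\<close> discards the zero coefficients.\<close>

lemma has_field_derivative_lacunary:
  fixes N :: "nat \<Rightarrow> nat" and z :: complex
  assumes N: "strict_mono N" "\<And>k. 0 < N k" and z: "norm z < 1"
  shows "((\<lambda>z. \<Sum>k. z ^ N k) has_field_derivative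
    (\<Sum>k. of_nat (N k) * z ^ (N k - 1))) (at z)"
proof -
  define c :: "nat \<Rightarrow> complex" where "c = indicator (range N)"
  have "summable (\<lambda>n. c n * w ^ n)" if "norm w < 1" for w
    by (rule summable_comparison_test'[OF summable_geometric[of "norm w"], of 0])
       (use that in \<open>auto simp: c_def norm_power indicator_def\<close>)
  hence d: "((\<lambda>z. \<Sum>n. c n * z ^ n) has_field_derivative (\<Sum>n. diffs c n * z ^ n)) (at z)"
    using z by (intro termdiffs_strong') auto
  have "(\<Sum>n. c n * w ^ n) = (\<Sum>k. w ^ N k)" for w
    using suminf_mono_reindex[OF N(1), of "\<lambda>n. c n * w ^ n"] by (simp add: c_def)
  moreover have "(\<Sum>n. diffs c n * z ^ n) = (\<Sum>k. of_nat (N k) * z ^ (N k - 1))"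
  proof -
    \<comment> \<open>Positivity of \<open>N\<close> matters here: truncated subtraction would merge
      the exponents 0 and 1.\<close>
    have "strict_mono (\<lambda>k. N k - 1)"
      using N by (intro strict_monoI diff_less_mono) (auto simp: strict_mono_def Suc_le_eq)
    moreover have "diffs c n * z ^ n = 0" if "n \<notin> range (\<lambda>k. N k - 1)" for n
    proof -
      have "Suc n \<notin> range N"
        using that by (auto simp: image_iff) (metis diff_Suc_Suc diff_zero)
      thus ?thesis by (simp add: diffs_def c_def)
    qed
    ultimately have "(\<Sum>k. diffs c (N k - 1) * z ^ (N k - 1)) = (\<Sum>n. diffs c n * z ^ n)"
      by (rule suminf_mono_reindex)
    moreover have "diffs c (N k - 1) = of_nat (N k)" for k
      using N(2)[of k] by (simp add: diffs_def c_def)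
    ultimately show ?thesis by simp
  qed
  ultimately show ?thesis using d by simp
qed

text \<open>Cut to zero off the disk, as membership in \<open>hol_disk\<close> demands.\<close>

definition lacunary_fun :: "(nat \<Rightarrow> nat) \<Rightarrow> complex \<Rightarrow> complex"
  where "lacunary_fun N z = (if z \<in> unit_disk then \<Sum>k. z ^ N k else 0)"

text \<open>Derivatives are local and the disk is open. This lets functions cut off outside the disk
  be differentiated through the formulas that define them inside.\<close>

lemma deriv_eq_on_disk:
  assumes "z \<in> unit_disk" "\<And>w. w \<in> unit_disk \<Longrightarrow> f w = g w"
  shows "deriv f z = deriv g z"
proof (rule deriv_cong_ev)
  show "eventually (\<lambda>w. f w = g w) (nhds z)"
    using eventually_nhds_in_open[OF open_ball assms(1)] by eventually_elim (rule assms(2))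
qed simp

lemma deriv_lacunary_fun:
  assumes "strict_mono N" "\<And>k. 0 < N k" "z \<in> unit_disk"
  shows "deriv (lacunary_fun N) z = (\<Sum>k. of_nat (N k) * z ^ (N k - 1))"
proof -
  have "deriv (lacunary_fun N) z = deriv (\<lambda>z. \<Sum>k. z ^ N k) z"
    by (rule deriv_eq_on_disk) (use assms in \<open>auto simp: lacunary_fun_def\<close>)
  also have "\<dots> = (\<Sum>k. of_nat (N k) * z ^ (N k - 1))"
    using has_field_derivative_lacunary[OF assms(1,2)] assms(3) by (intro DERIV_imp_deriv) auto
  finally show ?thesis .
qed

lemma one_minus_square_le:
  fixes r :: real
  assumes "0 \<le> r" "r < 1"
  shows "0 < 1 - r\<^sup>2" "1 - r\<^sup>2 \<le> 2 * (1 - r)" "1 - r \<le> 1 - r\<^sup>2"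
proof -
  have e: "1 - r\<^sup>2 = (1 + r) * (1 - r)" by (simp add: power2_eq_square algebra_simps)
  show "0 < 1 - r\<^sup>2" using e assms by simp
  show "1 - r\<^sup>2 \<le> 2 * (1 - r)" unfolding e using assms by (intro mult_right_mono) auto
  show "1 - r \<le> 1 - r\<^sup>2" unfolding e using assms mult_right_mono[of 1 "1+r" "1-r"] by auto
qed

lemma lacunary_fun_in_bloch_space:
  assumes "strict_mono N" "\<And>k. 0 < N k" "\<And>k. 2 * N k \<le> N (Suc k)"
  shows "lacunary_fun N \<in> bloch_space"
proof -
  have "(\<lambda>z. \<Sum>k. z ^ N k) holomorphic_on unit_disk"
  proof (rule holomorphic_onI)
    fix z :: complex assume "z \<in> unit_disk"
    hence "((\<lambda>z. \<Sum>k. z ^ N k) has_field_derivative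
        (\<Sum>k. of_nat (N k) * z ^ (N k - 1))) (at z)"
      by (intro has_field_derivative_lacunary assms) simp
    thus "(\<lambda>z. \<Sum>k. z ^ N k) field_differentiable at z within unit_disk"
      by (auto simp: field_differentiable_def intro: has_field_derivative_at_within)
  qed
  hence hol: "lacunary_fun N holomorphic_on unit_disk"
    by (rule holomorphic_transform) (simp add: lacunary_fun_def)
  \<comment> \<open>The 4 is the weight bound \<open>2 * (1 - r)\<close> times the derivative bound
    \<open>2 / (1 - r)\<close>.\<close>
  have "(1 - (norm z)\<^sup>2) * norm (deriv (lacunary_fun N) z) \<le> 4" if z: "z \<in> unit_disk" for z
  proof -
    let ?r = "norm z"
    have r: "0 \<le> ?r" "?r < 1" using z by auto
    note S = lacunary_summable[where N = N, OF r assms(3)]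
    have "norm (\<Sum>k. of_nat (N k) * z ^ (N k - 1)) \<le> (\<Sum>k. real (N k) * ?r ^ (N k - 1))"
      using S(1) by (intro norm_suminf_le) (auto simp: norm_mult norm_power)
    hence "norm (deriv (lacunary_fun N) z) \<le> 2 / (1 - ?r)"
      using S(2) deriv_lacunary_fun[OF assms(1,2) z] by simp
    hence "(1 - ?r\<^sup>2) * norm (deriv (lacunary_fun N) z) \<le> 2 * (1 - ?r) * (2 / (1 - ?r))"
      using one_minus_square_le[OF r] r by (intro mult_mono) auto
    also have "\<dots> = 4" using r by (simp add: field_simps)
    finally show ?thesis .
  qed
  hence "bdd_above ((\<lambda>z. (1 - (norm z)\<^sup>2) * norm (deriv (lacunary_fun N) z)) ` unit_disk)"
    by (intro bdd_aboveI2)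
  with hol show ?thesis
    by (auto simp: bloch_space_def hol_disk_def lacunary_fun_def)
qed

section \<open>Lower bounds for lacunary derivatives\<close>

text \<open>Cube \<open>x / 3 \<le> exp (x / 3)\<close>. Three is the least integer exponent that
  leaves a factor \<open>1 / Q\<close> even in the first tail term of the lacunary sum
  below.\<close>

lemma exp_minus_le_cube: "exp (- x) \<le> 27 / x ^ 3" if "0 < x" for x :: real
proof -
  have "(x / 3) ^ 3 \<le> exp (x / 3) ^ 3"
    using that exp_ge_add_one_self[of "x/3"] by (intro power_mono) linarith+
  also have "\<dots> = exp x" by (simp flip: exp_of_nat_mult)
  finally show ?thesis using that by (simp add: exp_minus field_simps power_divide)
qed

text \<open>Invert \<open>(1 + 1 / m) ^ m \<le> exp 1 \<le> 3\<close>, since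
  \<open>1 - 1 / (m + 1)\<close> is the reciprocal of \<open>1 + 1 / m\<close>.\<close>

lemma power_ge_third:
  fixes r :: real
  assumes m: "0 < m" and r: "1 - 1 / real (Suc m) \<le> r"
  shows "1 / 3 \<le> r ^ m"
proof -
  have "(1 + 1 / real m) ^ m \<le> exp (1 / real m) ^ m"
    by (intro power_mono) auto
  also have "\<dots> = exp 1" using m by (simp flip: exp_of_nat_mult)
  also have "\<dots> \<le> 3" by (rule exp_le)
  finally have "1 / 3 \<le> 1 / (1 + 1 / real m) ^ m"
    using m by (intro divide_left_mono) (auto intro!: mult_pos_pos zero_less_power add_pos_pos)
  also have "\<dots> = (1 / (1 + 1 / real m)) ^ m"
    by (simp add: power_one_over)
  also have "1 / (1 + 1 / real m) = 1 - 1 / real (Suc m)"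
    using m by (simp add: field_simps)
  also have "(1 - 1 / real (Suc m)) ^ m \<le> r ^ m"
    using r by (intro power_mono) auto
  finally show ?thesis .
qed

text \<open>On this annulus the term of index \<open>k\<close> dominates: the inner radius keeps its
  power of \<open>norm z\<close> above \<open>1/3\<close>, the gaps make the earlier terms small in
  total, and the outer radius makes the later powers decay faster than their coefficients
  grow.\<close>

lemma lacunary_lower_bound:
  fixes a Q k :: nat and z :: complex
  defines "N \<equiv> \<lambda>j. a * (Q\<^sup>2) ^ j"
  assumes Q: "1000 \<le> Q" and M: "2 \<le> N k"
    and z: "1 - 1 / real (N k) \<le> norm z" "norm z \<le> 1 - 1 / (real Q * real (N k))"
  shows "real (N k) / 5 \<le> norm (\<Sum>j. of_nat (N j) * z ^ (N j - 1))"
proof -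
  define r where "r = norm z"
  define t where "t = (\<lambda>j. of_nat (N j) * z ^ (N j - 1))"
  define M where "M = real (N k)"
  have Q0: "real Q \<ge> 1000" "real Q > 0" using Q by auto
  have Q2: "1000 \<le> Q\<^sup>2" using Q self_le_power[of Q 2] by linarith
  have M2: "M \<ge> 2" using M unfolding M_def by simp
  have step: "N (Suc j) \<ge> 1000 * N j" for j
    using mult_right_mono[OF Q2, of "N j"] by (simp add: N_def mult_ac)
  have step2: "2 * N j \<le> N (Suc j)" for j using step[of j] by linarith
  have r: "1/2 \<le> r" "r < 1" "r \<le> 1 - 1 / (real Q * M)"
  proof -
    have "1 / M \<le> 1/2" using M2 by (simp add: field_simps)
    thus "1/2 \<le> r" using z(1) unfolding r_def M_def by linarith
    show "r \<le> 1 - 1 / (real Q * M)" using z(2) unfolding r_def M_def .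
    moreover have "0 < 1 / (real Q * M)" using Q0 M2 by simp
    ultimately show "r < 1" by linarith
  qed
  have norm_t: "norm (t j) = real (N j) * r ^ (N j - 1)" for j
    by (simp add: t_def r_def norm_mult norm_power)
  have summable_norm_t: "summable (\<lambda>j. norm (t j))"
    unfolding norm_t using r step2 by (intro lacunary_summable(1)) auto

  have main: "M / 3 \<le> norm (t k)"
  proof -
    \<comment> \<open>The exponent is \<open>m = N k - 1\<close>, so \<open>Suc m\<close> is
      \<open>N k\<close> and the hypothesis is the inner radius of the annulus.\<close>
    have "1 / 3 \<le> r ^ (N k - 1)"
      using M z(1) unfolding r_def by (intro power_ge_third) auto
    thus ?thesis unfolding norm_t using M2 mult_left_mono[of "1/3" "r ^ (N k - 1)" M]
      by (simp add: M_def)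
  qed

  have low: "norm (\<Sum>j<k. t j) \<le> M / 100"
  proof -
    \<comment> \<open>The induction step needs only \<open>1/100 + 1 \<le> 1000/100\<close>, by the
      growth factor 1000.\<close>
    have "(\<Sum>j<n. real (N j)) \<le> real (N n) / 100" for n
    proof (induction n)
      case (Suc n)
      thus ?case using step[of n] by simp
    qed simp
    moreover have "norm (\<Sum>j<k. t j) \<le> (\<Sum>j<k. real (N j))"
      unfolding norm_t using r
      by (intro sum_norm_le) (auto simp: norm_t intro!: mult_left_le power_le_one)
    ultimately show ?thesis
      unfolding M_def by (rule order_trans[rotated])
  qed

  \<comment> \<open>The outer radius gives \<open>r ^ n \<le> exp (- (Q ^ (2 * j + 1)))\<close> for
    \<open>n = M * Q ^ (2 * j + 2)\<close>. After the cubic bound the power of \<open>Q\<close> left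
    over is \<open>2 * j + 2 - 3 * (2 * j + 1) = - 4 * j - 1\<close>: one \<open>1 / Q\<close>
    yields the \<open>1/1000\<close>, the rest the geometric factor. The 54 is 27 doubled.\<close>
  have tail_le: "norm (t (j + Suc k)) \<le> 54 / 1000 * M * (1/2) ^ j" for j
  proof -
    define n where "n = N (j + Suc k)"
    have n: "real n = M * real Q ^ (2 * j + 2)"
      by (simp add: n_def M_def N_def power_add power_mult power2_eq_square)
    have "0 < real n" unfolding n using M2 Q0 by (intro mult_pos_pos zero_less_power) linarith+
    hence "n > 0" by simp
    have "r \<le> exp (- (1 / (real Q * M)))"
      using r(3) exp_ge_add_one_self[of "- (1 / (real Q * M))"] by linarith
    hence "r ^ n \<le> exp (- (1 / (real Q * M))) ^ n"
      using r by (intro power_mono) auto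
    also have "\<dots> = exp (- (real n / (real Q * M)))"
      by (simp flip: exp_of_nat_mult)
    also have "real n / (real Q * M) = real Q ^ (2 * j + 1)"
      using M2 Q0 by (simp add: n field_simps)
    also have "exp (- (real Q ^ (2 * j + 1))) \<le> 27 / (real Q ^ (2 * j + 1)) ^ 3"
      using Q0 by (intro exp_minus_le_cube) simp
    finally have "r ^ n \<le> 27 / (real Q ^ (2 * j + 1)) ^ 3" .
    \<comment> \<open>The bound \<open>1/2 \<le> r\<close>, obtained from
      \<open>2 \<le> N k\<close>, pays for the shift of the exponent.\<close>
    moreover have "r ^ (n - 1) \<le> 2 * r ^ n"
      using mult_right_mono[of 1 "2 * r" "r ^ (n - 1)"] r
      by (simp add: mult.assoc mult.commute flip: power_minus_mult[OF \<open>n > 0\<close>, of r])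
    ultimately have "r ^ (n - 1) \<le> 54 / (real Q ^ (2 * j + 1)) ^ 3" by simp
    hence "norm (t (j + Suc k)) \<le> M * real Q ^ (2 * j + 2) * (54 / (real Q ^ (2 * j + 1)) ^ 3)"
      unfolding norm_t n_def[symmetric] n using M2 by (intro mult_left_mono) auto
    also have "\<dots> = 54 * M * (1 / real Q) * (1 / real Q ^ 4) ^ j"
    proof -
      define x where "x = real Q ^ j"
      have x: "x > 0" using Q0 by (simp add: x_def)
      have "real Q ^ (2 * j) = x\<^sup>2" "(1 / real Q ^ 4) ^ j = 1 / x ^ 4"
        by (simp_all add: x_def power_one_over mult.commute flip: power_mult)
      thus ?thesis using x Q0
        by (simp add: power_add field_simps power2_eq_square power3_eq_cube power4_eq_xxxx)
    qed
    also have "\<dots> \<le> 54 * M * (1 / 1000) * (1 / 2) ^ j"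
    proof -
      have "real Q \<le> real Q ^ 4" using Q0 by (intro self_le_power) auto
      hence "2 \<le> real Q ^ 4" using Q0 by linarith
      hence "1 / real Q ^ 4 \<le> 1 / 2" using Q0 by (intro divide_left_mono) auto
      moreover have "1 / real Q \<le> 1 / 1000" using Q0 by (simp add: field_simps)
      ultimately show ?thesis using M2 Q0
        by (intro mult_mono power_mono mult_nonneg_nonneg) auto
    qed
    finally show ?thesis by simp
  qed
  have summable_half: "summable (\<lambda>j. (1/2::real) ^ j)" by (simp add: summable_geometric)
  have tail: "norm (\<Sum>j. t (j + Suc k)) \<le> 108 / 1000 * M"
  proof -
    have "norm (\<Sum>j. t (j + Suc k)) \<le> (\<Sum>j. 54 / 1000 * M * (1/2) ^ j)"
      using tail_le summable_half by (intro norm_suminf_le summable_mult) auto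
    also have "\<dots> = 54 / 1000 * M * 2"
      using suminf_mult[OF summable_half, of "54 / 1000 * M"] suminf_geometric[of "1/2::real"]
      by simp
    finally show ?thesis by simp
  qed

  have "(\<Sum>j. t j) = (\<Sum>j. t (j + Suc k)) + ((\<Sum>j<k. t j) + t k)"
    using suminf_split_initial_segment[OF summable_norm_cancel[OF summable_norm_t], of "Suc k"]
    by simp
  hence "t k = (\<Sum>j. t j) - (\<Sum>j. t (j + Suc k)) - (\<Sum>j<k. t j)" by simp
  hence "norm (t k) \<le> norm (\<Sum>j. t j) + norm (\<Sum>j. t (j + Suc k)) + norm (\<Sum>j<k. t j)"
    using norm_triangle_ineq4[of "(\<Sum>j. t j) - (\<Sum>j. t (j + Suc k))" "\<Sum>j<k. t j"]
      norm_triangle_ineq4[of "\<Sum>j. t j" "\<Sum>j. t (j + Suc k)"] by simp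
  \<comment> \<open>The constants fit because \<open>1/3 - 1/100 - 108/1000\<close> exceeds
    \<open>1/5\<close>.\<close>
  with main low tail M2 have "M / 5 \<le> norm (\<Sum>j. t j)" by linarith
  thus ?thesis by (simp add: M_def t_def)
qed

text \<open>Take the predecessor of the least exponent whose power exceeds \<open>x\<close>. With
  \<open>x = 1 / (1 - norm z)\<close> this selects the annulus that contains
  \<open>z\<close>.\<close>

lemma power_bracket:
  fixes x b :: real
  assumes "1 < b" "b \<le> x"
  obtains m where "1 \<le> m" "b ^ m \<le> x" "x < b ^ Suc m"
proof -
  define n where "n = (LEAST n. x < b ^ n)"
  have ex: "x < b ^ n" unfolding n_def by (rule LeastI_ex) (rule real_arch_pow[OF assms(1)])
  have "n \<noteq> 0"
  proof
    assume "n = 0"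
    with ex assms show False by simp
  qed
  \<comment> \<open>Excluding 1 makes \<open>m\<close> positive, which later guarantees
    \<open>2 \<le> N a k\<close>.\<close>
  moreover have "n \<noteq> 1"
  proof
    assume "n = 1"
    with ex assms show False by simp
  qed
  ultimately obtain m where m: "n = Suc m" "1 \<le> m" by (cases n) auto
  have "\<not> x < b ^ m" using not_less_Least[of m "\<lambda>n. x < b ^ n"] m(1) n_def by simp
  with ex m show ?thesis by (intro that[of m]) auto
qed

text \<open>A family is required, not a single function: if one \<open>f\<close> satisfied the bound
  on the whole disk, then \<open>1 / deriv f\<close> would be analytic and tend to 0 at the
  boundary, against the maximum principle.\<close>

lemma bloch_functions_maximal_growth:
  obtains F K where "finite F" "F \<subseteq> bloch_space" "0 < K"
    "\<And>z. z \<in> unit_disk \<Longrightarrow> \<exists>f\<in>F. 1 / (1 - (norm z)\<^sup>2) \<le> K * norm (deriv f z)"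
proof -
  define Q :: nat where "Q = 1000"
  \<comment> \<open>\<open>N 1\<close> runs through the even powers of \<open>Q\<close> and
    \<open>N Q\<close> through the odd ones.\<close>
  define N :: "nat \<Rightarrow> nat \<Rightarrow> nat" where "N = (\<lambda>a j. a * (Q\<^sup>2) ^ j)"
  define e :: "complex \<Rightarrow> complex" where "e = (\<lambda>z. if z \<in> unit_disk then z else 0)"
  have N: "strict_mono (N a)" "0 < N a k" "2 * N a k \<le> N a (Suc k)" if "0 < a" for a k
    using that by (auto simp: N_def Q_def strict_mono_Suc_iff)
  have deriv_e: "deriv e z = 1" if "z \<in> unit_disk" for z
    using deriv_eq_on_disk[OF that, of e "\<lambda>z. z"] by (simp add: e_def)
  have "e \<in> bloch_space"
  proof -
    have "e holomorphic_on unit_disk"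
      by (rule holomorphic_transform[OF holomorphic_on_ident]) (simp add: e_def)
    moreover have "bdd_above ((\<lambda>z. (1 - (norm z)\<^sup>2) * norm (deriv e z)) ` unit_disk)"
      by (rule bdd_aboveI2[of _ _ 1]) (simp add: deriv_e)
    ultimately show ?thesis by (auto simp: bloch_space_def hol_disk_def e_def)
  qed
  let ?F = "{e, lacunary_fun (N 1), lacunary_fun (N Q)}"
  \<comment> \<open>The 5 is the loss in the lower bound for the dominant term, and \<open>Q\<close>
    is the ratio between the values of \<open>1 / (1 - norm z)\<close> at the two edges of an
    annulus.\<close>
  have "\<exists>f\<in>?F. 1 / (1 - (norm z)\<^sup>2) \<le> 5 * real Q * norm (deriv f z)" if z: "z \<in> unit_disk" for z
  proof -
    define r where "r = norm z"
    have r: "0 \<le> r" "r < 1" using z by (auto simp: r_def)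
    have le: "1 / (1 - r\<^sup>2) \<le> 1 / (1 - r)"
      using one_minus_square_le[OF r] r by (intro divide_left_mono) auto
    show ?thesis
    proof (cases "1 / (1 - r) < real Q")
      case True
      hence "1 / (1 - r\<^sup>2) \<le> 5 * real Q * norm (deriv e z)"
        using le by (simp add: deriv_e[OF z])
      thus ?thesis unfolding r_def by blast
    next
      case False
      \<comment> \<open>Equivalently, \<open>1 - 1 / Q ^ m \<le> r < 1 - 1 / Q ^ Suc m\<close>. The
        parity of \<open>m\<close> decides which of the two series is used.\<close>
      then obtain m where m: "1 \<le> m" "real Q ^ m \<le> 1 / (1 - r)" "1 / (1 - r) < real Q ^ Suc m"
        using power_bracket[of "real Q" "1 / (1 - r)"] by (auto simp: Q_def)
      obtain a k where ak: "a \<in> {1, Q}" "Q ^ m = N a k"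
      proof (cases "even m")
        case True
        then obtain k where "m = 2 * k" by blast
        thus ?thesis by (intro that[of 1 k]) (auto simp: N_def power_mult)
      next
        case False
        then obtain k where "m = 2 * k + 1" by (elim oddE)
        thus ?thesis by (intro that[of Q k]) (auto simp: N_def power_mult)
      qed
      have a: "0 < a" using ak(1) by (auto simp: Q_def)
      have M: "real (N a k) = real Q ^ m" using ak(2) by (metis of_nat_power)
      have "Q ^ 1 \<le> Q ^ m" using m(1) by (intro power_increasing) (auto simp: Q_def)
      hence "2 \<le> N a k" using ak(2) by (simp add: Q_def)
      moreover have "1 - 1 / real (N a k) \<le> norm z"
        using m(2) r unfolding M r_def[symmetric] by (simp add: field_simps Q_def)
      moreover have "norm z \<le> 1 - 1 / (real Q * real (N a k))"
        using m(3) r unfolding M r_def[symmetric] by (simp add: field_simps Q_def)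
      ultimately have "real (N a k) / 5 \<le> norm (\<Sum>j. of_nat (N a j) * z ^ (N a j - 1))"
        unfolding N_def by (intro lacunary_lower_bound) (auto simp: Q_def)
      also have "(\<Sum>j. of_nat (N a j) * z ^ (N a j - 1)) = deriv (lacunary_fun (N a)) z"
        using N[OF a] z by (intro deriv_lacunary_fun[symmetric]) auto
      finally have "real Q * real (N a k) \<le> 5 * real Q * norm (deriv (lacunary_fun (N a)) z)"
        by (simp add: Q_def)
      hence "1 / (1 - r\<^sup>2) \<le> 5 * real Q * norm (deriv (lacunary_fun (N a)) z)"
        using m(3) le unfolding M by simp
      thus ?thesis using ak(1) unfolding r_def by blast
    qed
  qed
  moreover have "?F \<subseteq> bloch_space"
    using \<open>e \<in> bloch_space\<close> lacunary_fun_in_bloch_space N by (auto simp: Q_def)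
  ultimately show ?thesis by (intro that[of ?F "5 * real Q"]) (auto simp: Q_def)
qed

section \<open>Growth of Bloch functions\<close>

lemma bloch_deriv_le:
  assumes "f \<in> bloch_space" "w \<in> unit_disk"
  defines "s \<equiv> SUP z\<in>unit_disk. (1 - (norm z)\<^sup>2) * norm (deriv f z)"
  shows "norm (deriv f w) \<le> s / (1 - (norm w)\<^sup>2)" and "0 \<le> s"
proof -
  have le: "(1 - (norm z)\<^sup>2) * norm (deriv f z) \<le> s" if "z \<in> unit_disk" for z
    unfolding s_def using assms(1) that by (intro cSUP_upper) (auto simp: bloch_space_def)
  have "0 < 1 - (norm w)\<^sup>2" using one_minus_square_le[of "norm w"] assms(2) by simp
  thus "norm (deriv f w) \<le> s / (1 - (norm w)\<^sup>2)"
    using le[OF assms(2)] by (simp add: field_simps)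
  show "0 \<le> s" using le[of 0] by (simp add: order_trans[OF norm_ge_zero])
qed

text \<open>Mean value estimate from 0 to \<open>w\<close>: on the convex ball of radius
  \<open>norm w\<close> the Bloch weight is at least \<open>1 - (norm w)\<^sup>2\<close>. With
  \<open>w = \<phi> 0\<close> it controls the value at 0 in the norm of
  \<open>comp_op \<phi> f\<close>.\<close>

lemma bloch_point_evaluation_bounded:
  assumes "w \<in> unit_disk"
  obtains L where "0 \<le> L" "\<And>f. f \<in> bloch_space \<Longrightarrow> norm (f w) \<le> L * bloch_norm f"
proof
  define c where "c = norm w / (1 - (norm w)\<^sup>2)"
  have w: "norm w < 1" "0 < 1 - (norm w)\<^sup>2"
    using assms one_minus_square_le[of "norm w"] by auto
  have c: "0 \<le> c" using w by (simp add: c_def)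
  thus "0 \<le> 1 + c" by simp
  fix f assume f: "f \<in> bloch_space"
  define s where "s = (SUP z\<in>unit_disk. (1 - (norm z)\<^sup>2) * norm (deriv f z))"
  have s: "0 \<le> s" using bloch_deriv_le(2)[OF f assms] by (simp add: s_def)
  have "norm (f w - f 0) \<le> s / (1 - (norm w)\<^sup>2) * norm (w - 0)"
  proof (rule field_differentiable_bound[where S = "cball 0 (norm w)" and f' = "deriv f"])
    fix z :: complex assume "z \<in> cball 0 (norm w)"
    hence zw: "norm z \<le> norm w" by simp
    hence z: "z \<in> unit_disk" using w by simp
    have "f holomorphic_on unit_disk" using f by (simp add: bloch_space_def hol_disk_def)
    from holomorphic_derivI[OF this open_ball z]
    show "(f has_field_derivative deriv f z) (at z within cball 0 (norm w))"
      by (rule has_field_derivative_at_within)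
    have "norm (deriv f z) \<le> s / (1 - (norm z)\<^sup>2)"
      unfolding s_def by (rule bloch_deriv_le(1)[OF f z])
    also have "\<dots> \<le> s / (1 - (norm w)\<^sup>2)"
    proof -
      have "(norm z)\<^sup>2 \<le> (norm w)\<^sup>2" using zw by (intro power_mono) auto
      thus ?thesis using s w(2) by (intro divide_left_mono mult_pos_pos; linarith)
    qed
    finally show "norm (deriv f z) \<le> s / (1 - (norm w)\<^sup>2)" .
  qed auto
  hence "norm (f w - f 0) \<le> c * s" by (simp add: c_def mult.commute)
  hence "norm (f w) \<le> norm (f 0) + c * s"
    using norm_triangle_sub[of "f w" "f 0"] by linarith
  also have "\<dots> \<le> (1 + c) * (norm (f 0) + s)"
    using c s by (simp add: algebra_simps)
  finally show "norm (f w) \<le> (1 + c) * bloch_norm f" by (simp add: bloch_norm_def s_def)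
qed

section \<open>Composition with self-maps, and measurability\<close>

lemma disk_self_map_in_disk:
  "disk_self_map \<phi> \<Longrightarrow> z \<in> unit_disk \<Longrightarrow> \<phi> z \<in> unit_disk"
  unfolding disk_self_map_def by blast

lemma disk_self_map_comp_aut:
  assumes "disk_self_map \<phi>" "\<sigma> \<in> disk_aut"
  shows "disk_self_map (\<phi> \<circ> \<sigma>)"
proof -
  have \<sigma>: "\<sigma> holomorphic_on unit_disk" "\<sigma> ` unit_disk = unit_disk"
    using assms(2) by (auto simp: disk_aut_def bij_betw_def)
  hence "(\<phi> \<circ> \<sigma>) holomorphic_on unit_disk"
    using assms(1) by (intro holomorphic_on_compose) (auto simp: disk_self_map_def)
  moreover have "(\<phi> \<circ> \<sigma>) ` unit_disk = \<phi> ` unit_disk"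
    by (simp only: image_comp[symmetric] \<sigma>(2))
  ultimately show ?thesis using assms(1) by (simp only: disk_self_map_def)
qed

text \<open>Since \<open>\<sigma>\<close> preserves the disk, the cut-off in \<open>comp_op\<close>
  disappears there and the chain rule applies to
  \<open>f \<circ> (\<phi> \<circ> \<sigma>)\<close>.\<close>

lemma norm_deriv_comp_op:
  assumes "f \<in> hol_disk" "disk_self_map \<phi>" "\<sigma> \<in> disk_aut" "z \<in> unit_disk"
  shows "norm (deriv (comp_op \<phi> f \<circ> \<sigma>) z)
    = norm (deriv f ((\<phi> \<circ> \<sigma>) z)) * norm (deriv (\<phi> \<circ> \<sigma>) z)"
proof -
  have \<psi>: "(\<phi> \<circ> \<sigma>) holomorphic_on unit_disk" "(\<phi> \<circ> \<sigma>) z \<in> unit_disk"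
    using disk_self_map_comp_aut[OF assms(2,3)] disk_self_map_in_disk[OF _ assms(4)]
    unfolding disk_self_map_def by blast+
  have "deriv (comp_op \<phi> f \<circ> \<sigma>) z = deriv (f \<circ> (\<phi> \<circ> \<sigma>)) z"
    by (rule deriv_eq_on_disk[OF assms(4)])
       (use assms(3) in \<open>force simp: comp_op_def disk_aut_def bij_betw_def\<close>)
  also have "\<dots> = deriv f ((\<phi> \<circ> \<sigma>) z) * deriv (\<phi> \<circ> \<sigma>) z"
    using \<psi> assms(1,4)
    by (intro deriv_chain holomorphic_on_imp_differentiable_at[of _ unit_disk])
       (auto simp: hol_disk_def)
  finally show ?thesis by (simp only: norm_mult)
qed

lemma comp_op_in_hol_disk:
  assumes "f \<in> hol_disk" "disk_self_map \<phi>"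
  shows "comp_op \<phi> f \<in> hol_disk"
proof -
  have "(f \<circ> \<phi>) holomorphic_on unit_disk"
    using assms by (auto simp: hol_disk_def disk_self_map_def
        intro: holomorphic_on_compose holomorphic_on_subset)
  hence "comp_op \<phi> f holomorphic_on unit_disk"
    by (rule holomorphic_transform) (simp add: comp_op_def)
  thus ?thesis by (simp add: hol_disk_def comp_op_def)
qed

text \<open>The measure lives on the restricted Borel sets, so values off the disk, arbitrary for
  self-maps and their derivatives, cannot spoil measurability.\<close>

lemma borel_measurable_disk:
  fixes g :: "complex \<Rightarrow> 'a::topological_space"
  assumes "sets \<mu> = sets (restrict_space borel unit_disk)" "continuous_on unit_disk g"
  shows "g \<in> borel_measurable \<mu>"
  using borel_measurable_continuous_on_restrict[OF assms(2)]
  by (simp add: measurable_cong_sets[OF assms(1) refl])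

lemma continuous_on_deriv_disk:
  "f holomorphic_on unit_disk \<Longrightarrow> continuous_on unit_disk (deriv f)"
  by (intro holomorphic_on_imp_continuous_on holomorphic_deriv) auto

lemma borel_measurable_hyp_deriv:
  assumes "sets \<mu> = sets (restrict_space borel unit_disk)" "disk_self_map \<psi>"
  shows "hyp_deriv \<psi> \<in> borel_measurable \<mu>"
proof (rule borel_measurable_disk[OF assms(1)])
  have "\<psi> holomorphic_on unit_disk" using assms(2) by (simp add: disk_self_map_def)
  moreover have "1 - (norm (\<psi> z))\<^sup>2 \<noteq> 0" if "z \<in> unit_disk" for z
  proof -
    have "norm (\<psi> z) < 1" using disk_self_map_in_disk[OF assms(2) that] by simp
    thus ?thesis using one_minus_square_le(1)[of "norm (\<psi> z)"] by simp
  qed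
  ultimately show "continuous_on unit_disk (hyp_deriv \<psi>)"
    unfolding hyp_deriv_def
    by (intro continuous_intros continuous_on_deriv_disk holomorphic_on_imp_continuous_on) auto
qed

section \<open>Two-sided comparison with the hyperbolic derivative\<close>

text \<open>The Bloch bound on \<open>deriv f\<close> at \<open>(\<phi> \<circ> \<sigma>) z\<close>
  supplies precisely the denominator of \<open>hyp_deriv\<close>, so the integrands compare
  pointwise.\<close>

lemma dirichlet_integral_comp_op_le:
  assumes "0 < p" and \<mu>: "sets \<mu> = sets (restrict_space borel unit_disk)"
    and \<phi>: "disk_self_map \<phi>" "\<sigma> \<in> disk_aut" and f: "f \<in> bloch_space"
  defines "s \<equiv> SUP z\<in>unit_disk. (1 - (norm z)\<^sup>2) * norm (deriv f z)"
  shows "dirichlet_integral p \<mu> (comp_op \<phi> f \<circ> \<sigma>)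
    \<le> ennreal (s powr p) * (\<integral>\<^sup>+ z. ennreal (hyp_deriv (\<phi> \<circ> \<sigma>) z powr p) \<partial>\<mu>)"
proof -
  let ?\<psi> = "\<phi> \<circ> \<sigma>"
  have \<psi>: "disk_self_map ?\<psi>" using \<phi> by (rule disk_self_map_comp_aut)
  have space: "space \<mu> = unit_disk" using sets_eq_imp_space_eq[OF \<mu>] by simp
  note [measurable] = borel_measurable_hyp_deriv[OF \<mu> \<psi>]
  have "norm (deriv (comp_op \<phi> f \<circ> \<sigma>) z) powr p \<le> s powr p * hyp_deriv ?\<psi> z powr p"
    if z: "z \<in> unit_disk" for z
  proof -
    have \<psi>z: "?\<psi> z \<in> unit_disk" using \<psi> z by (rule disk_self_map_in_disk)
    have s: "0 \<le> s" unfolding s_def by (rule bloch_deriv_le(2)[OF f z])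
    have "norm (deriv (comp_op \<phi> f \<circ> \<sigma>) z) = norm (deriv f (?\<psi> z)) * norm (deriv ?\<psi> z)"
      using f by (intro norm_deriv_comp_op \<phi> z) (simp add: bloch_space_def)
    also have "\<dots> \<le> s / (1 - (norm (?\<psi> z))\<^sup>2) * norm (deriv ?\<psi> z)"
      unfolding s_def by (intro mult_right_mono bloch_deriv_le(1)[OF f \<psi>z]) auto
    also have "\<dots> = s * hyp_deriv ?\<psi> z" by (simp add: hyp_deriv_def)
    finally have "norm (deriv (comp_op \<phi> f \<circ> \<sigma>) z) powr p \<le> (s * hyp_deriv ?\<psi> z) powr p"
      using \<open>0 < p\<close> by (intro powr_mono2) auto
    thus ?thesis by (simp add: powr_mult)
  qed
  hence "dirichlet_integral p \<mu> (comp_op \<phi> f \<circ> \<sigma>)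
      \<le> (\<integral>\<^sup>+ z. ennreal (s powr p) * ennreal (hyp_deriv ?\<psi> z powr p) \<partial>\<mu>)"
    unfolding dirichlet_integral_def
    by (intro nn_integral_mono) (auto simp: space ennreal_mult[symmetric])
  also have "\<dots> = ennreal (s powr p) * (\<integral>\<^sup>+ z. ennreal (hyp_deriv ?\<psi> z powr p) \<partial>\<mu>)"
    by (intro nn_integral_cmult) measurable
  finally show ?thesis .
qed

text \<open>The growth bound on \<open>F\<close> is evaluated at
  \<open>(\<phi> \<circ> \<sigma>) z\<close> and multiplied by the derivative of
  \<open>\<phi> \<circ> \<sigma>\<close>, which reverses the preceding estimate.\<close>

lemma hyp_deriv_integral_le_sum:
  assumes "0 < p" and \<mu>: "sets \<mu> = sets (restrict_space borel unit_disk)"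
    and \<phi>: "disk_self_map \<phi>" "\<sigma> \<in> disk_aut"
    and F: "finite F" "F \<subseteq> hol_disk"
    and K: "0 < K" "\<And>z. z \<in> unit_disk \<Longrightarrow> \<exists>f\<in>F. 1 / (1 - (norm z)\<^sup>2) \<le> K * norm (deriv f z)"
  shows "(\<integral>\<^sup>+ z. ennreal (hyp_deriv (\<phi> \<circ> \<sigma>) z powr p) \<partial>\<mu>)
    \<le> ennreal (K powr p) * (\<Sum>f\<in>F. dirichlet_integral p \<mu> (comp_op \<phi> f \<circ> \<sigma>))"
proof -
  let ?\<psi> = "\<phi> \<circ> \<sigma>"
  let ?D = "\<lambda>f z. ennreal (norm (deriv (comp_op \<phi> f \<circ> \<sigma>) z) powr p)"
  have \<psi>: "disk_self_map ?\<psi>" using \<phi> by (rule disk_self_map_comp_aut)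
  have space: "space \<mu> = unit_disk" using sets_eq_imp_space_eq[OF \<mu>] by simp
  have meas [measurable]: "?D f \<in> borel_measurable \<mu>" if "f \<in> F" for f
  proof -
    have "comp_op \<phi> f \<circ> \<sigma> holomorphic_on unit_disk"
      using comp_op_in_hol_disk[of f \<phi>] F(2) that \<phi>
      by (intro holomorphic_on_compose) (auto simp: hol_disk_def disk_aut_def bij_betw_def)
    hence [measurable]: "deriv (comp_op \<phi> f \<circ> \<sigma>) \<in> borel_measurable \<mu>"
      by (intro borel_measurable_disk[OF \<mu>] continuous_on_deriv_disk)
    show ?thesis by measurable
  qed
  have "ennreal (hyp_deriv ?\<psi> z powr p) \<le> ennreal (K powr p) * (\<Sum>f\<in>F. ?D f z)"
    if z: "z \<in> unit_disk" for z
  proof -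
    have \<psi>z: "?\<psi> z \<in> unit_disk" using \<psi> z by (rule disk_self_map_in_disk)
    obtain f where f: "f \<in> F" "1 / (1 - (norm (?\<psi> z))\<^sup>2) \<le> K * norm (deriv f (?\<psi> z))"
      using K(2)[OF \<psi>z] by blast
    have pos: "0 < 1 - (norm (?\<psi> z))\<^sup>2"
      using \<psi>z one_minus_square_le(1)[of "norm (?\<psi> z)"] by simp
    have "hyp_deriv ?\<psi> z = 1 / (1 - (norm (?\<psi> z))\<^sup>2) * norm (deriv ?\<psi> z)"
      by (simp add: hyp_deriv_def)
    also have "\<dots> \<le> K * norm (deriv f (?\<psi> z)) * norm (deriv ?\<psi> z)"
      using f(2) by (rule mult_right_mono) simp
    also have "\<dots> = K * norm (deriv (comp_op \<phi> f \<circ> \<sigma>) z)"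
      using norm_deriv_comp_op[OF _ \<phi> z, of f] F(2) f(1) by auto
    finally have "hyp_deriv ?\<psi> z powr p \<le> (K * norm (deriv (comp_op \<phi> f \<circ> \<sigma>) z)) powr p"
      using \<open>0 < p\<close> pos by (intro powr_mono2) (auto simp: hyp_deriv_def)
    hence "ennreal (hyp_deriv ?\<psi> z powr p) \<le> ennreal (K powr p) * ?D f z"
      by (simp add: powr_mult ennreal_mult[symmetric])
    \<comment> \<open>The function \<open>f\<close> depends on \<open>z\<close>; summing over
      \<open>F\<close> gives an integrand free of that choice.\<close>
    also have "\<dots> \<le> ennreal (K powr p) * (\<Sum>f\<in>F. ?D f z)"
      using f(1) F(1) by (intro mult_left_mono member_le_sum) auto
    finally show ?thesis .
  qed
  hence "(\<integral>\<^sup>+ z. ennreal (hyp_deriv ?\<psi> z powr p) \<partial>\<mu>)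
      \<le> (\<integral>\<^sup>+ z. ennreal (K powr p) * (\<Sum>f\<in>F. ?D f z) \<partial>\<mu>)"
    by (intro nn_integral_mono) (simp add: space)
  also have "\<dots> = ennreal (K powr p) * (\<integral>\<^sup>+ z. (\<Sum>f\<in>F. ?D f z) \<partial>\<mu>)"
    by (intro nn_integral_cmult borel_measurable_sum) (rule meas)
  also have "(\<integral>\<^sup>+ z. (\<Sum>f\<in>F. ?D f z) \<partial>\<mu>) = (\<Sum>f\<in>F. \<integral>\<^sup>+ z. ?D f z \<partial>\<mu>)"
    by (intro nn_integral_sum) (rule meas)
  finally show ?thesis by (simp only: dirichlet_integral_def)
qed

section \<open>The implications between (a), (b) and (c)\<close>

text \<open>The test family does not depend on \<open>\<sigma>\<close>, so the finitely many suprema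
  given by (a) bound all the integrals at once.\<close>

lemma hyp_deriv_integrals_finite:
  assumes p: "0 < p" and \<mu>: "sets \<mu> = sets (restrict_space borel unit_disk)"
    and \<phi>: "disk_self_map \<phi>"
    and maps: "\<And>f. f \<in> bloch_space \<Longrightarrow> comp_op \<phi> f \<in> mobius_space p \<mu>"
  shows "(SUP \<sigma>\<in>disk_aut. \<integral>\<^sup>+ z. ennreal (hyp_deriv (\<phi> \<circ> \<sigma>) z powr p) \<partial>\<mu>) < \<infinity>"
proof -
  obtain F K where F: "finite F" "F \<subseteq> bloch_space" and K: "0 < K"
    "\<And>z. z \<in> unit_disk \<Longrightarrow> \<exists>f\<in>F. 1 / (1 - (norm z)\<^sup>2) \<le> K * norm (deriv f z)"
    using bloch_functions_maximal_growth by blast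
  let ?S = "\<lambda>f. SUP \<sigma>\<in>disk_aut. dirichlet_integral p \<mu> (comp_op \<phi> f \<circ> \<sigma>)"
  have hol: "F \<subseteq> hol_disk" using F(2) by (auto simp: bloch_space_def)
  have "(SUP \<sigma>\<in>disk_aut. \<integral>\<^sup>+ z. ennreal (hyp_deriv (\<phi> \<circ> \<sigma>) z powr p) \<partial>\<mu>)
      \<le> ennreal (K powr p) * (\<Sum>f\<in>F. ?S f)"
  proof (rule SUP_least)
    fix \<sigma> assume \<sigma>: "\<sigma> \<in> disk_aut"
    have "(\<integral>\<^sup>+ z. ennreal (hyp_deriv (\<phi> \<circ> \<sigma>) z powr p) \<partial>\<mu>)
        \<le> ennreal (K powr p) * (\<Sum>f\<in>F. dirichlet_integral p \<mu> (comp_op \<phi> f \<circ> \<sigma>))"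
      by (rule hyp_deriv_integral_le_sum[OF p \<mu> \<phi> \<sigma> F(1) hol K])
    also have "\<dots> \<le> ennreal (K powr p) * (\<Sum>f\<in>F. ?S f)"
      using \<sigma> by (intro mult_left_mono sum_mono SUP_upper) auto
    finally show "(\<integral>\<^sup>+ z. ennreal (hyp_deriv (\<phi> \<circ> \<sigma>) z powr p) \<partial>\<mu>)
      \<le> ennreal (K powr p) * (\<Sum>f\<in>F. ?S f)" .
  qed
  also have "\<dots> < \<infinity>"
    using maps F by (auto simp: mobius_space_def ennreal_mult_less_top subset_iff)
  finally show ?thesis .
qed

lemma comp_op_bounded:
  assumes p: "0 < p" and \<mu>: "sets \<mu> = sets (restrict_space borel unit_disk)"
    and \<phi>: "disk_self_map \<phi>"
    and fin: "(SUP \<sigma>\<in>disk_aut. \<integral>\<^sup>+ z. ennreal (hyp_deriv (\<phi> \<circ> \<sigma>) z powr p) \<partial>\<mu>) < \<infinity>"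
  shows "bounded_operator bloch_space bloch_norm
    (mobius_space p \<mu>) (mobius_norm p \<mu>) (comp_op \<phi>)"
proof -
  define I where "I = (SUP \<sigma>\<in>disk_aut. \<integral>\<^sup>+ z. ennreal (hyp_deriv (\<phi> \<circ> \<sigma>) z powr p) \<partial>\<mu>)"
  define S where "S = (\<lambda>f. SUP \<sigma>\<in>disk_aut. dirichlet_integral p \<mu> (comp_op \<phi> f \<circ> \<sigma>))"
  have I: "I < \<infinity>" using fin by (simp add: I_def)
  have S_le: "S f \<le> ennreal (bloch_norm f powr p) * I" and norm_nonneg: "0 \<le> bloch_norm f"
    if f: "f \<in> bloch_space" for f
  proof -
    define s where "s = (SUP z\<in>unit_disk. (1 - (norm z)\<^sup>2) * norm (deriv f z))"
    have s: "0 \<le> s" unfolding s_def by (rule bloch_deriv_le(2)[OF f, of 0]) simp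
    hence s_le: "s \<le> bloch_norm f" by (simp add: bloch_norm_def s_def)
    with s show "0 \<le> bloch_norm f" by simp
    show "S f \<le> ennreal (bloch_norm f powr p) * I"
      unfolding S_def
    proof (rule SUP_least)
      fix \<sigma> assume \<sigma>: "\<sigma> \<in> disk_aut"
      have "dirichlet_integral p \<mu> (comp_op \<phi> f \<circ> \<sigma>)
          \<le> ennreal (s powr p) * (\<integral>\<^sup>+ z. ennreal (hyp_deriv (\<phi> \<circ> \<sigma>) z powr p) \<partial>\<mu>)"
        unfolding s_def by (rule dirichlet_integral_comp_op_le[OF p \<mu> \<phi> \<sigma> f])
      also have "\<dots> \<le> ennreal (bloch_norm f powr p) * I"
        unfolding I_def using \<sigma> s s_le p
        by (intro mult_mono SUP_upper ennreal_leI powr_mono2) auto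
      finally show "dirichlet_integral p \<mu> (comp_op \<phi> f \<circ> \<sigma>) \<le> ennreal (bloch_norm f powr p) * I" .
    qed
  qed
  have maps: "comp_op \<phi> f \<in> mobius_space p \<mu>" if f: "f \<in> bloch_space" for f
  proof -
    have "comp_op \<phi> f \<in> hol_disk"
      using f \<phi> by (intro comp_op_in_hol_disk) (auto simp: bloch_space_def)
    moreover have "S f < \<infinity>"
      using I by (intro le_less_trans[OF S_le[OF f]]) (simp add: ennreal_mult_less_top)
    ultimately show ?thesis by (simp add: mobius_space_def S_def)
  qed
  have "\<phi> 0 \<in> unit_disk" using \<phi> by (rule disk_self_map_in_disk) simp
  then obtain L where L: "0 \<le> L" "\<And>f. f \<in> bloch_space \<Longrightarrow> norm (f (\<phi> 0)) \<le> L * bloch_norm f"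
    using bloch_point_evaluation_bounded by blast
  \<comment> \<open>The \<open>p\<close>-th power of the target norm splits into the value at
    \<open>\<phi> 0\<close>, at most \<open>(L * bloch_norm f) powr p\<close>, and the supremum, at
    most \<open>bloch_norm f powr p * I\<close>; \<open>C\<close> is the \<open>p\<close>-th root of
    the joint factor.\<close>
  define C where "C = (L powr p + enn2real I) powr (1 / p)"
  have "mobius_norm p \<mu> (comp_op \<phi> f) \<le> C * bloch_norm f" if f: "f \<in> bloch_space" for f
  proof -
    let ?n = "bloch_norm f"
    \<comment> \<open>\<open>enn2real\<close> sends infinity to 0, so it is monotone only below a
      finite bound; finiteness of \<open>I\<close> provides one.\<close>
    have "enn2real (S f) \<le> enn2real (ennreal (?n powr p) * I)"
      using I by (intro enn2real_mono S_le f) (simp add: ennreal_mult_less_top)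
    hence "enn2real (S f) \<le> ?n powr p * enn2real I" by (simp add: enn2real_mult)
    moreover have "norm (f (\<phi> 0)) powr p \<le> (L * ?n) powr p"
      using L(2)[OF f] p by (intro powr_mono2) auto
    ultimately have "norm (f (\<phi> 0)) powr p + enn2real (S f)
        \<le> ?n powr p * (L powr p + enn2real I)"
      by (simp add: powr_mult algebra_simps)
    hence "(norm (f (\<phi> 0)) powr p + enn2real (S f)) powr (1 / p)
        \<le> (?n powr p * (L powr p + enn2real I)) powr (1 / p)"
      using p by (intro powr_mono2) auto
    also have "\<dots> = C * ?n"
      using p norm_nonneg[OF f] by (simp add: powr_mult powr_powr C_def)
    finally show ?thesis by (simp add: mobius_norm_def S_def comp_op_def)
  qed
  thus ?thesis using maps by (auto simp: bounded_operator_def comp_op_def fun_eq_iff)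
qed

theorem proposition2:
  fixes p :: real and \<mu> :: "complex measure" and \<phi> :: "complex \<Rightarrow> complex"
  assumes "1 \<le> p"
    and "sets \<mu> = sets (restrict_space borel unit_disk)"
    and "banach_function_space (dirichlet_space p \<mu>) (dirichlet_norm p \<mu>)"
    and "\<And>K. compact K \<Longrightarrow> K \<subseteq> unit_disk \<Longrightarrow>
           \<exists>C. \<forall>\<zeta>\<in>K. \<forall>f\<in>dirichlet_space p \<mu>. norm (f \<zeta>) \<le> C * dirichlet_norm p \<mu> f"
    and "disk_self_map \<phi>"
  shows "((\<forall>f\<in>bloch_space. comp_op \<phi> f \<in> mobius_space p \<mu>)
          \<longleftrightarrow> bounded_operator bloch_space bloch_norm
                (mobius_space p \<mu>) (mobius_norm p \<mu>) (comp_op \<phi>))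
       \<and> (bounded_operator bloch_space bloch_norm
                (mobius_space p \<mu>) (mobius_norm p \<mu>) (comp_op \<phi>)
          \<longleftrightarrow> (SUP \<sigma>\<in>disk_aut. \<integral>\<^sup>+ z. ennreal (hyp_deriv (\<phi> \<circ> \<sigma>) z powr p) \<partial>\<mu>) < \<infinity>)"
proof -
  have "0 < p" using assms(1) by simp
  note * = this assms(2,5)
  \<comment> \<open>The cycle is (a) to (c) to (b), and (b) contains (a) by definition.\<close>
  show ?thesis
    using hyp_deriv_integrals_finite[OF *] comp_op_bounded[OF *]
    by (auto simp: bounded_operator_def)
qed

end
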